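(* Let $m\ge1$. If $z=1$, then $\mathrm{TD}(\mathrm{QR}^1_{\infty,m})=3$. If $z\ge2$, then for every $\pi\in\mathrm{QR}^z_{\infty,m}$, $\mathrm{TD}(\pi,\mathrm{QR}^z_{\infty,m})=O\big(2^{|\pi(\varepsilon)|}+D\cdot(|\pi(\varepsilon)|+D\cdot m)^{D\cdot m}\big)$, where $D:=\max\{\tfrac1m(2|\pi|-|\pi(\varepsilon)|),\;1+(|\pi(\varepsilon)|+m+4)\cdot|\mathrm{Var}(\pi)|\}$; in particular it is finite.
   Context: Fix a countably infinite set $X$ of variables and an alphabet $\Sigma$ (finite or countably infinite, disjoint from $X$), $z=|\Sigma|$. A pattern is a nonempty finite string over $X\cup\Sigma$; $\mathrm{Var}(\pi)$ is its set of variables, $|\pi|$ its length, $\pi(\varepsilon)$ the word obtained by deleting all variables. A substitution is a morphism $h:(X\cup\Sigma)^*\to\Sigma^*$ fixing letters; $L(\pi)$ (erasing pattern language) is the set of all $h(\pi)$. A pattern is $m$-quasi-regular if every variable occurring in it occurs exactly $m$ times; $\mathrm{QR}^z_{\infty,m}$ is the class of all $m$-quasi-regular patterns over an alphabet of size $z$. A labelled example is $(w,\pm)$ with $w\in\Sigma^*$; a teaching set for $\pi$ w.r.t. a class $\Pi$ is a set $T$ of labelled examples consistent with $\pi$ ($w\in L(\pi)$ iff the label is $+$) such that every $\tau\in\Pi$ consistent with $T$ has $L(\tau)=L(\pi)$; $\mathrm{TD}(\pi,\Pi)$ is its minimum size ($\infty$ if none finite), and $\mathrm{TD}(\Pi)=\sup_{\pi\in\Pi}\mathrm{TD}(\pi,\Pi)$.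 *)

theory Defs
  imports Complex_Main "HOL-Library.Extended_Nat" "HOL-Library.Countable"
begin

text \<open>Symbols of patterns: variables (X = nat, countably infinite) and letters of the
alphabet 'a (finite or countably infinite).\<close>
datatype 'a sym = Var nat | Ter 'a

type_synonym 'a pattern = "'a sym list"

definition is_pattern :: "'a pattern \<Rightarrow> bool" where
  "is_pattern p \<longleftrightarrow> p \<noteq> []"

definition vars :: "'a pattern \<Rightarrow> nat set" where
  "vars p = {x. Var x \<in> set p}"

definition erase_vars :: "'a pattern \<Rightarrow> 'a list" where
  "erase_vars p = concat (map (\<lambda>s. case s of Var x \<Rightarrow> [] | Ter a \<Rightarrow> [a]) p)"

definition subst :: "(nat \<Rightarrow> 'a list) \<Rightarrow> 'a pattern \<Rightarrow> 'a list" where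
  "subst h p = concat (map (\<lambda>s. case s of Var x \<Rightarrow> h x | Ter a \<Rightarrow> [a]) p)"

definition lang :: "'a pattern \<Rightarrow> 'a list set" where
  "lang p = {subst h p | h. True}"

definition quasi_regular :: "nat \<Rightarrow> 'a pattern \<Rightarrow> bool" where
  "quasi_regular m p \<longleftrightarrow> (\<forall>x \<in> vars p. count_list p (Var x) = m)"

definition QR :: "nat \<Rightarrow> 'a pattern set" where
  "QR m = {p. is_pattern p \<and> quasi_regular m p}"

text \<open>Labelled examples (w, True) = (w,+), (w, False) = (w,-).\<close>
definition consistent :: "('a list \<times> bool) set \<Rightarrow> 'a pattern \<Rightarrow> bool" where
  "consistent T p \<longleftrightarrow> (\<forall>(w, b) \<in> T. (w \<in> lang p) = b)"

definition teaching_set :: "('a list \<times> bool) set \<Rightarrow> 'a pattern \<Rightarrow> 'a pattern set \<Rightarrow> bool" where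
  "teaching_set T p \<Pi> \<longleftrightarrow> consistent T p \<and>
     (\<forall>q \<in> \<Pi>. consistent T q \<longrightarrow> lang q = lang p)"

text \<open>TD(pi, Pi); infinity if no finite teaching set exists (Inf {} = infinity).\<close>
definition TD :: "'a pattern \<Rightarrow> 'a pattern set \<Rightarrow> enat" where
  "TD p \<Pi> = Inf {enat (card T) | T. finite T \<and> teaching_set T p \<Pi>}"

definition TD_class :: "'a pattern set \<Rightarrow> enat" where
  "TD_class \<Pi> = Sup ((\<lambda>p. TD p \<Pi>) ` \<Pi>)"

end

theory Submission
  imports Defs "HOL-Library.Sublist"
begin

text \<open>
  Let \<open>w = \<pi>(\<epsilon>)\<close>, \<open>e = |w|\<close> and \<open>v = |Var \<pi>|\<close>. The example \<open>(w, +)\<close> and the proper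
  subsequences of \<open>w\<close> as negative examples force a consistent \<open>\<tau>\<close> to satisfy
  \<open>\<tau>(\<epsilon>) = w\<close>. One further example is spent on each language other than \<open>L(\<pi>)\<close> of a pattern with
  constant part \<open>w\<close> and at most \<open>K = 3v + e + m + 1\<close> variables (\<open>K = 1\<close> if \<open>v = 0\<close>);
  it is negative whenever the language is not contained in \<open>L(\<pi>)\<close>.

  To see that this suffices, erase a variable \<open>z\<close> of \<open>\<tau>\<close> whenever some variable \<open>y\<close> is always
  immediately followed by \<open>z\<close>; this does not change the language, and it ends in a reduced pattern.
  If the reduced pattern has more than \<open>K\<close> variables, it can be thinned out to a reduced pattern \<open>\<rho>\<close>
  with more than \<open>3v + e\<close> but at most \<open>K\<close> variables, because erasing one variable from a reduced
  pattern creates at most \<open>m\<close> new adjacencies. Such a \<open>\<rho>\<close> has \<open>\<not> L(\<rho>) \<subseteq> L(\<pi>)\<close>: substitute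
  \<open>y\<^sub>i \<mapsto> a b\<^sup>n a\<close> with \<open>n = e + 1 + i\<close> and suppose the result is \<open>h(\<pi>)\<close>. At most \<open>2v\<close> variables have all their
  blocks cut by the boundaries of the images of the variables of \<open>\<pi>\<close>. Every other block recurs at a fixed offset in
  the image \<open>h(x)\<close> of a single variable \<open>x\<close>, so variables that are neighbours inside \<open>h(x)\<close> must be
  separated by a letter of \<open>w\<close> in a reduced pattern, which leaves at most \<open>v + e\<close> of them.
\<close>

section \<open>Substitutions, constant parts and lengths of images\<close>

lemma subst_simps [simp]:
  "subst h [] = []"
  "subst h (Var x # p) = h x @ subst h p"
  "subst h (Ter c # p) = c # subst h p"
  "subst h (p @ q) = subst h p @ subst h q"
  by (simp_all add: subst_def)

lemma erase_vars_simps [simp]: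
  "erase_vars [] = []"
  "erase_vars (Var x # p) = erase_vars p"
  "erase_vars (Ter c # p) = c # erase_vars p"
  "erase_vars (p @ q) = erase_vars p @ erase_vars q"
  by (simp_all add: erase_vars_def)

lemma vars_simps [simp]:
  "vars [] = {}"
  "vars (Var x # p) = insert x (vars p)"
  "vars (Ter c # p) = vars p"
  "vars (p @ q) = vars p \<union> vars q"
  by (auto simp: vars_def)

lemma finite_vars [simp]: "finite (vars p)"
proof (induction p)
  case (Cons s p)
  then show ?case by (cases s) auto
qed simp

lemma subst_in_lang [simp]: "subst h p \<in> lang p"
  by (auto simp: lang_def)

lemma subst_cong: "(\<And>x. x \<in> vars p \<Longrightarrow> h x = g x) \<Longrightarrow> subst h p = subst g p"
proof (induction p)
  case (Cons s p)
  then show ?case by (cases s) auto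
qed simp

lemma subst_Nil_eq_erase_vars: "subst (\<lambda>_. []) p = erase_vars p"
proof (induction p)
  case (Cons s p)
  then show ?case by (cases s) auto
qed simp

lemma erase_vars_in_lang: "erase_vars p \<in> lang p"
  by (metis subst_in_lang subst_Nil_eq_erase_vars)

lemma subseq_erase_vars_subst: "subseq (erase_vars p) (subst h p)"
proof (induction p)
  case (Cons s p)
  then show ?case by (cases s) (auto simp: list_emb_append2)
qed simp

lemma count_list_Var_eq_0: "x \<notin> vars p \<Longrightarrow> count_list p (Var x) = 0"
  by (simp add: vars_def)

lemma length_subst:
  "length (subst h p) = length (erase_vars p) + (\<Sum>x\<in>vars p. count_list p (Var x) * length (h x))"
proof (induction p)
  case (Cons s p)
  show ?case
  proof (cases s)
    case (Var y)
    have "(\<Sum>x\<in>insert y (vars p). count_list (Var y # p) (Var x) * length (h x)) =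
        (\<Sum>x\<in>insert y (vars p). (if x = y then length (h x) else 0) + count_list p (Var x) * length (h x))"
      by (rule sum.cong) auto
    also have "\<dots> = length (h y) + (\<Sum>x\<in>insert y (vars p). count_list p (Var x) * length (h x))"
      by (simp add: sum.distrib)
    also have "(\<Sum>x\<in>insert y (vars p). count_list p (Var x) * length (h x)) =
        (\<Sum>x\<in>vars p. count_list p (Var x) * length (h x))"
      by (cases "y \<in> vars p") (auto simp: insert_absorb count_list_Var_eq_0)
    finally show ?thesis using Var Cons by simp
  qed (use Cons in simp)
qed simp

lemma length_subst_quasi_regular:
  assumes "quasi_regular m p"
  shows "length (subst h p) = length (erase_vars p) + m * (\<Sum>x\<in>vars p. length (h x))"
  using assms by (simp add: length_subst quasi_regular_def sum_distrib_left)

lemma length_lang_ge: "u \<in> lang p \<Longrightarrow> length (erase_vars p) \<le> length u"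
  by (auto simp: lang_def length_subst)

section \<open>Subpatterns\<close>

text \<open>Erasing variables keeps the constant part and the multiplicity \<open>m\<close>, and can
  only shrink the language. The result may be \<open>[]\<close>, so the lemmas on subpatterns speak
  of \<open>quasi_regular m\<close> rather than of \<open>QR m\<close>.\<close>

definition subpattern :: "'a pattern \<Rightarrow> 'a pattern \<Rightarrow> bool" where
  "subpattern q p \<longleftrightarrow> (\<exists>Z. q = filter (\<lambda>s. s \<notin> Var ` Z) p)"

lemma subpattern_refl [simp]: "subpattern p p"
  unfolding subpattern_def by (rule exI[of _ "{}"]) simp

lemma subpattern_trans: "subpattern r q \<Longrightarrow> subpattern q p \<Longrightarrow> subpattern r p"
proof -
  assume "subpattern r q" "subpattern q p"
  then obtain Y Z where "q = filter (\<lambda>s. s \<notin> Var ` Z) p" "r = filter (\<lambda>s. s \<notin> Var ` Y) q"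
    by (auto simp: subpattern_def)
  then have "r = filter (\<lambda>s. s \<notin> Var ` (Y \<union> Z)) p"
    by (auto intro!: filter_cong)
  then show ?thesis unfolding subpattern_def by blast
qed

lemma subpattern_removeAll: "subpattern (removeAll (Var z) p) p"
  unfolding subpattern_def
  by (rule exI[of _ "{z}"]) (auto simp: removeAll_filter_not_eq intro!: filter_cong)

lemma vars_filter: "vars (filter (\<lambda>s. s \<notin> Var ` Z) p) = vars p - Z"
  by (auto simp: vars_def)

lemma vars_removeAll: "vars (removeAll (Var z) p) = vars p - {z}"
  by (auto simp: vars_def)

lemma erase_vars_filter: "erase_vars (filter (\<lambda>s. s \<notin> Var ` Z) p) = erase_vars p"
proof (induction p)
  case (Cons s p)
  then show ?case by (cases s) auto
qed simp

lemma subpattern_erase_vars: "subpattern q p \<Longrightarrow> erase_vars q = erase_vars p"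
  by (auto simp: subpattern_def erase_vars_filter)

lemma subst_filter:
  "subst h (filter (\<lambda>s. s \<notin> Var ` Z) p) = subst (\<lambda>x. if x \<in> Z then [] else h x) p"
proof (induction p)
  case (Cons s p)
  then show ?case by (cases s) auto
qed simp

lemma subpattern_lang: "subpattern q p \<Longrightarrow> lang q \<subseteq> lang p"
  by (auto simp: subpattern_def lang_def subst_filter)

lemma count_list_filter_Var:
  "x \<notin> Z \<Longrightarrow> count_list (filter (\<lambda>s. s \<notin> Var ` Z) p) (Var x) = count_list p (Var x)"
proof (induction p)
  case (Cons s p)
  then show ?case by (cases s) auto
qed simp

lemma subpattern_quasi_regular:
  assumes "subpattern q p" "quasi_regular m p"
  shows "quasi_regular m q"
proof -
  obtain Z where q: "q = filter (\<lambda>s. s \<notin> Var ` Z) p" using assms(1) by (auto simp: subpattern_def)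
  show ?thesis
    unfolding quasi_regular_def
  proof
    fix x assume "x \<in> vars q"
    then have "x \<in> vars p" "x \<notin> Z" by (auto simp: q vars_filter)
    then show "count_list q (Var x) = m"
      using assms(2) count_list_filter_Var[of x Z p] unfolding q quasi_regular_def by metis
  qed
qed

section \<open>Reduced patterns\<close>

text \<open>Vacuously true if \<open>y\<close> does not occur, which is why
  \<open>successors\<close> lets \<open>y\<close> range over \<open>vars p\<close>.\<close>

fun followed :: "nat \<Rightarrow> nat \<Rightarrow> 'a pattern \<Rightarrow> bool" where
  "followed y z [] = True"
| "followed y z (s # p) = ((s = Var y \<longrightarrow> (\<exists>p'. p = Var z # p')) \<and> followed y z p)"

text \<open>For \<open>y\<close> and \<open>z\<close> distinct, this adds to \<open>followed\<close>
  that every \<open>z\<close> is preceded by \<open>y\<close>. The inductive form gives an induction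
  that consumes a whole pair at once.\<close>

inductive linked :: "nat \<Rightarrow> nat \<Rightarrow> 'a pattern \<Rightarrow> bool" for y z where
  "linked y z []"
| "linked y z p \<Longrightarrow> s \<noteq> Var y \<Longrightarrow> s \<noteq> Var z \<Longrightarrow> linked y z (s # p)"
| "linked y z p \<Longrightarrow> linked y z (Var y # Var z # p)"

text \<open>A pattern \<open>p\<close> is reduced if \<open>successors p = {}\<close>.\<close>

definition successors :: "'a pattern \<Rightarrow> nat set" where
  "successors p = {z. \<exists>y \<in> vars p. followed y z p}"

lemma not_followed_self: "y \<in> vars p \<Longrightarrow> \<not> followed y y p"
proof (induction p)
  case (Cons s p)
  then show ?case by (cases s) auto
qed simp

lemma followed_vars: "followed y z p \<Longrightarrow> y \<in> vars p \<Longrightarrow> z \<in> vars p"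
proof (induction p)
  case (Cons s p)
  then show ?case by (cases s) auto
qed simp

lemma successors_subset: "successors p \<subseteq> vars p"
  by (auto simp: successors_def followed_vars)

lemma followed_count_le:
  "followed y z p \<Longrightarrow> y \<noteq> z \<Longrightarrow> count_list p (Var y) \<le> count_list p (Var z)"
proof (induction "length p" arbitrary: p rule: less_induct)
  case less
  show ?case
  proof (cases p)
    case (Cons s r)
    show ?thesis
    proof (cases "s = Var y")
      case True
      then obtain r' where r': "r = Var z # r'" using less.prems Cons by auto
      have "count_list r' (Var y) \<le> count_list r' (Var z)"
        by (rule less.hyps) (use less.prems Cons r' in simp_all)
      then show ?thesis using less.prems Cons True r' by simp
    next
      case False
      have "count_list r (Var y) \<le> count_list r (Var z)"
        by (rule less.hyps) (use less.prems Cons in simp_all)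
      then show ?thesis using Cons False by simp
    qed
  qed simp
qed

text \<open>A leading \<open>z\<close> without a \<open>y\<close> before it would leave a rest with
  more \<open>y\<close> than \<open>z\<close>, against \<open>followed_count_le\<close>.
  Quasi-regularity will supply the equal counts.\<close>

lemma linked_if_followed:
  "followed y z p \<Longrightarrow> y \<noteq> z \<Longrightarrow> count_list p (Var y) = count_list p (Var z) \<Longrightarrow> linked y z p"
proof (induction "length p" arbitrary: p rule: less_induct)
  case less
  show ?case
  proof (cases p)
    case (Cons s r)
    consider "s = Var y" | "s = Var z" | "s \<noteq> Var y" "s \<noteq> Var z" by blast
    then show ?thesis
    proof cases
      case 1
      then obtain r' where r': "r = Var z # r'" using less.prems Cons by auto
      have "linked y z r'"
        by (rule less.hyps) (use less.prems Cons r' 1 in simp_all)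
      then show ?thesis using Cons 1 r' by (simp add: linked.intros)
    next
      case 2
      then show ?thesis using followed_count_le[of y z r] less.prems Cons by simp
    next
      case 3
      have "linked y z r"
        by (rule less.hyps) (use less.prems Cons 3 in simp_all)
      then show ?thesis using Cons 3 by (simp add: linked.intros)
    qed
  qed (simp add: linked.intros)
qed

lemma linked_hd: "linked y z (s # p) \<Longrightarrow> y \<noteq> z \<Longrightarrow> s \<noteq> Var z"
  by (auto elim: linked.cases)

text \<open>The images of \<open>y\<close> and \<open>z\<close> are always adjacent, so
  \<open>y\<close> can absorb that of \<open>z\<close>.\<close>

lemma subst_linked:
  "linked y z p \<Longrightarrow> y \<noteq> z \<Longrightarrow> subst (h(y := h y @ h z)) (removeAll (Var z) p) = subst h p"
proof (induction rule: linked.induct)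
  case (2 p s)
  then show ?case by (cases s) auto
qed auto

lemma lang_linked: "linked y z p \<Longrightarrow> y \<noteq> z \<Longrightarrow> lang (removeAll (Var z) p) = lang p"
proof
  assume *: "linked y z p" "y \<noteq> z"
  show "lang (removeAll (Var z) p) \<subseteq> lang p"
    by (simp add: subpattern_lang subpattern_removeAll)
  show "lang p \<subseteq> lang (removeAll (Var z) p)"
  proof
    fix u assume "u \<in> lang p"
    then obtain h where "u = subst h p" by (auto simp: lang_def)
    then show "u \<in> lang (removeAll (Var z) p)"
      using subst_linked[OF *, of h] by (metis subst_in_lang)
  qed
qed

text \<open>Since \<open>z\<close> stands only behind \<open>y\<close>, erasing it does not change
  what comes after any other variable.\<close>

lemma linked_removeAll_followed_other:
  "linked y z p \<Longrightarrow> y \<noteq> z \<Longrightarrow> c \<noteq> y \<Longrightarrow> c \<noteq> z \<Longrightarrow> followed c d (removeAll (Var z) p) \<Longrightarrow> followed c d p"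
proof (induction rule: linked.induct)
  case (2 p s)
  show ?case
  proof (cases "s = Var c")
    case True
    then obtain p' where "removeAll (Var z) p = Var d # p'" using 2 by auto
    moreover have "p \<noteq> []" using calculation by auto
    then obtain t r where "p = t # r" by (cases p) auto
    moreover have "t \<noteq> Var z" using linked_hd 2 calculation by blast
    ultimately show ?thesis using 2 True by auto
  qed (use 2 in auto)
qed auto

text \<open>After the erasure \<open>y\<close> inherits whatever came after
  \<open>z\<close>.\<close>

lemma linked_removeAll_followed_self:
  "linked y z p \<Longrightarrow> y \<noteq> z \<Longrightarrow> followed y d (removeAll (Var z) p) \<Longrightarrow> followed z d p"
proof (induction rule: linked.induct)
  case (3 p)
  then obtain p' where "removeAll (Var z) p = Var d # p'" by auto
  moreover have "p \<noteq> []" using calculation by auto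
  then obtain t r where "p = t # r" by (cases p) auto
  moreover have "t \<noteq> Var z" using linked_hd 3 calculation by blast
  ultimately show ?case using 3 by auto
qed auto

lemma successors_linked:
  assumes "linked y z p" "y \<noteq> z" "z \<in> vars p"
  shows "successors (removeAll (Var z) p) \<subseteq> successors p - {z}"
proof
  fix d assume d: "d \<in> successors (removeAll (Var z) p)"
  then obtain c where c: "c \<in> vars p" "c \<noteq> z" "followed c d (removeAll (Var z) p)"
    by (auto simp: successors_def vars_removeAll)
  have "d \<noteq> z" using d successors_subset[of "removeAll (Var z) p"] by (auto simp: vars_removeAll)
  moreover have "d \<in> successors p"
  proof (cases "c = y")
    case True
    then show ?thesis using linked_removeAll_followed_self[of y z p d] assms c
      by (auto simp: successors_def)
  next
    case False
    then show ?thesis using linked_removeAll_followed_other[of y z p c d] assms c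
      by (auto simp: successors_def)
  qed
  ultimately show "d \<in> successors p - {z}" by blast
qed

text \<open>Each erasure costs one variable and, by \<open>successors_linked\<close>, at least one
  successor. Hence at most \<open>card (successors p)\<close> variables are lost.\<close>

lemma exists_reduced_subpattern:
  assumes "quasi_regular m p"
  shows "\<exists>q. subpattern q p \<and> lang q = lang p \<and> successors q = {} \<and>
    card (vars p) \<le> card (vars q) + card (successors p)"
  using assms
proof (induction "card (successors p)" arbitrary: p rule: less_induct)
  case less
  show ?case
  proof (cases "successors p = {}")
    case True
    then show ?thesis by (intro exI[of _ p]) auto
  next
    case False
    then obtain y z where yz: "y \<in> vars p" "followed y z p" by (auto simp: successors_def)
    have z: "z \<in> vars p" "y \<noteq> z" using yz followed_vars not_followed_self by blast+
    have l: "linked y z p"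
      by (rule linked_if_followed) (use yz z less.prems in \<open>auto simp: quasi_regular_def\<close>)
    let ?r = "removeAll (Var z) p"
    have zs: "z \<in> successors p" using yz by (auto simp: successors_def)
    have fin: "finite (successors p)" using successors_subset finite_vars by (rule finite_subset)
    have sc: "card (successors ?r) \<le> card (successors p) - 1"
      using card_mono[OF _ successors_linked[OF l z(2) z(1)]] zs fin by simp
    moreover have "card (successors p) > 0" using zs fin by (auto simp: card_gt_0_iff)
    ultimately have lt: "card (successors ?r) < card (successors p)" by linarith
    from less.hyps[OF lt] less.prems subpattern_quasi_regular[OF subpattern_removeAll]
    obtain q where q: "subpattern q ?r" "lang q = lang ?r" "successors q = {}"
      "card (vars ?r) \<le> card (vars q) + card (successors ?r)" by blast
    have "card (vars ?r) = card (vars p) - 1" "card (vars p) > 0"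
      using z by (auto simp: vars_removeAll card_gt_0_iff)
    then have "card (vars p) \<le> card (vars q) + card (successors p)"
      using q(4) sc lt by linarith
    then show ?thesis
      using q lang_linked[OF l z(2)] subpattern_trans[OF q(1) subpattern_removeAll] by auto
  qed
qed

section \<open>Thinning out reduced patterns\<close>

lemma followed_removeAll_gap:
  assumes "followed y d (removeAll (Var z) p)" "\<not> followed y d p" "y \<noteq> z"
  shows "\<exists>k. Suc k < length p \<and> p ! k = Var y \<and> p ! Suc k = Var z"
  using assms
proof (induction p)
  case (Cons s p)
  show ?case
  proof (cases "\<not> followed y d p")
    case True
    have "followed y d (removeAll (Var z) p)" using Cons.prems(1) by (auto split: if_splits)
    then obtain k where "Suc k < length p \<and> p ! k = Var y \<and> p ! Suc k = Var z"
      using Cons True by blast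
    then show ?thesis by (intro exI[of _ "Suc k"]) auto
  next
    case False
    then have s: "s = Var y" "\<nexists>p'. p = Var d # p'" using Cons.prems by auto
    then obtain p' where p': "removeAll (Var z) p = Var d # p'" using Cons.prems by auto
    then obtain t r where t: "p = t # r" by (cases p) auto
    then have "t = Var z" using s p' by (auto split: if_splits)
    then show ?thesis using s t by (intro exI[of _ 0]) auto
  qed
qed simp

lemma card_occurrences: "card {k. k < length p \<and> p ! k = s} = count_list p s"
  by (auto simp: count_list_eq_length_filter length_filter_conv_card intro!: arg_cong[where f = card])

lemma followed_unique: "followed y d p \<Longrightarrow> followed y d' p \<Longrightarrow> y \<in> vars p \<Longrightarrow> d = d'"
proof (induction p)
  case (Cons s p)
  then show ?case by (cases s) auto
qed simp

text \<open>A new successor \<open>d\<close> of some \<open>y\<close> arises only where an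
  occurrence of \<open>z\<close> right behind \<open>y\<close> was erased. That occurrence
  determines \<open>y\<close> and hence \<open>d\<close>, and \<open>z\<close> has only
  \<open>m\<close> occurrences.\<close>

lemma card_successors_removeAll:
  assumes "successors p = {}" "quasi_regular m p" "z \<in> vars p"
  shows "card (successors (removeAll (Var z) p)) \<le> m"
proof -
  let ?q = "removeAll (Var z) p"
  let ?O = "{k. k < length p \<and> p ! k = Var z}"
  have "\<forall>d \<in> successors ?q. \<exists>k. \<exists>y \<in> vars ?q. Suc k \<in> ?O \<and> p ! k = Var y \<and> followed y d ?q"
  proof
    fix d assume d: "d \<in> successors ?q"
    obtain y where y: "y \<in> vars ?q" "followed y d ?q" using d by (auto simp: successors_def)
    then have "\<not> followed y d p" "y \<noteq> z" using assms(1) by (auto simp: successors_def vars_removeAll)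
    then obtain k where "Suc k < length p" "p ! k = Var y" "p ! Suc k = Var z"
      using followed_removeAll_gap[OF y(2)] by blast
    then show "\<exists>k. \<exists>y \<in> vars ?q. Suc k \<in> ?O \<and> p ! k = Var y \<and> followed y d ?q" using y by blast
  qed
  then obtain f where f: "\<forall>d \<in> successors ?q. \<exists>y \<in> vars ?q. Suc (f d) \<in> ?O \<and> p ! f d = Var y \<and> followed y d ?q"
    by (rule bchoice[THEN exE])
  have "inj_on (\<lambda>d. Suc (f d)) (successors ?q)"
  proof (rule inj_onI)
    fix d d' assume *: "d \<in> successors ?q" "d' \<in> successors ?q" "Suc (f d) = Suc (f d')"
    then obtain y y' where "y \<in> vars ?q" "p ! f d = Var y" "followed y d ?q" "p ! f d' = Var y'" "followed y' d' ?q"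
      using f by blast
    moreover have "f d = f d'" using *(3) by simp
    ultimately show "d = d'" using followed_unique[of y d ?q d'] by simp
  qed
  then have "card (successors ?q) \<le> card ?O"
    by (rule card_inj_on_le) (use f in auto)
  also have "\<dots> = m" using assms card_occurrences[of p "Var z"] by (auto simp: quasi_regular_def)
  finally show ?thesis .
qed

text \<open>Erasing one variable and reducing again loses at most \<open>m + 1\<close> variables, so
  the descent cannot jump over the window from \<open>R + 1\<close> to
  \<open>R + m + 1\<close>.\<close>

lemma exists_reduced_subpattern_bounded:
  assumes "quasi_regular m p" "successors p = {}" "R < card (vars p)"
  shows "\<exists>q. subpattern q p \<and> successors q = {} \<and> R < card (vars q) \<and> card (vars q) \<le> R + m + 1"
  using assms
proof (induction "card (vars p)" arbitrary: p rule: less_induct)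
  case less
  show ?case
  proof (cases "card (vars p) \<le> R + m + 1")
    case True
    then show ?thesis using less by (intro exI[of _ p]) auto
  next
    case False
    then obtain z where z: "z \<in> vars p" by fastforce
    let ?r = "removeAll (Var z) p"
    have r: "subpattern ?r p" "quasi_regular m ?r"
      using subpattern_removeAll subpattern_quasi_regular less.prems by blast+
    obtain q where q: "subpattern q ?r" "successors q = {}"
      "card (vars ?r) \<le> card (vars q) + card (successors ?r)"
      using exists_reduced_subpattern[OF r(2)] by blast
    have vr: "card (vars ?r) = card (vars p) - 1" using z by (simp add: vars_removeAll)
    have gt: "R < card (vars q)"
      using q(3) vr False card_successors_removeAll[OF less.prems(2,1) z] by linarith
    have "vars q \<subseteq> vars ?r" using q(1) by (auto simp: subpattern_def vars_filter)
    then have "card (vars q) \<le> card (vars p) - 1" using vr card_mono finite_vars by metis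
    then have lt: "card (vars q) < card (vars p)" using less.prems by linarith
    from less.hyps[OF lt subpattern_quasi_regular[OF q(1) r(2)] q(2) gt]
    show ?thesis using q(1) r(1) subpattern_trans by metis
  qed
qed

section \<open>Reduced patterns contained in a given pattern language\<close>

definition img :: "(nat \<Rightarrow> 'a list) \<Rightarrow> 'a sym \<Rightarrow> 'a list" where
  "img h s = (case s of Var x \<Rightarrow> h x | Ter c \<Rightarrow> [c])"

definition start :: "(nat \<Rightarrow> 'a list) \<Rightarrow> 'a pattern \<Rightarrow> nat \<Rightarrow> nat" where
  "start h p k = length (subst h (take k p))"

lemma img_simps [simp]: "img h (Var x) = h x" "img h (Ter c) = [c]"
  by (simp_all add: img_def)

lemma subst_Cons: "subst h (s # p) = img h s @ subst h p"
  by (cases s) auto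

lemma start_0 [simp]: "start h p 0 = 0"
  by (simp add: start_def)

lemma start_length [simp]: "start h p (length p) = length (subst h p)"
  by (simp add: start_def)

lemma start_Suc: "k < length p \<Longrightarrow> start h p (Suc k) = start h p k + length (img h (p ! k))"
  by (simp add: start_def take_Suc_conv_app_nth subst_Cons)

lemma start_mono: "k \<le> l \<Longrightarrow> start h p k \<le> start h p l"
proof -
  assume "k \<le> l"
  then have "take l p = take k p @ take (l - k) (drop k p)"
    by (metis le_add_diff_inverse take_add)
  then show ?thesis by (simp add: start_def)
qed

lemma subst_nth:
  assumes "k < length p" "r < length (img h (p ! k))"
  shows "subst h p ! (start h p k + r) = img h (p ! k) ! r" "start h p k + r < length (subst h p)"
proof -
  have "p = take k p @ p ! k # drop (Suc k) p" using assms by (simp add: id_take_nth_drop)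
  then have "subst h p = subst h (take k p) @ img h (p ! k) @ subst h (drop (Suc k) p)"
    by (metis subst_Cons subst_simps(4))
  then show "subst h p ! (start h p k + r) = img h (p ! k) ! r" "start h p k + r < length (subst h p)"
    using assms by (auto simp: start_def nth_append)
qed

lemma start_locate:
  assumes "i < length (subst h p)"
  obtains k where "k < length p" "start h p k \<le> i" "i < start h p (Suc k)"
proof -
  define k where "k = (LEAST k. i < start h p (Suc k))"
  have ex: "i < start h p (Suc (length p - 1))"
    using assms by (cases p) (auto simp: start_def)
  have k: "i < start h p (Suc k)" unfolding k_def using ex by (rule LeastI[of "\<lambda>k. i < start h p (Suc k)"])
  have "k \<le> length p - 1" unfolding k_def using ex by (rule Least_le[of "\<lambda>k. i < start h p (Suc k)"])
  moreover have "p \<noteq> []" using assms by auto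
  ultimately have "k < length p" by (cases p) auto
  moreover have "start h p k \<le> i"
  proof (cases k)
    case (Suc j)
    then have "\<not> i < start h p (Suc j)" using not_less_Least[of j "\<lambda>k. i < start h p (Suc k)"] k_def by simp
    then show ?thesis using Suc by simp
  qed simp
  ultimately show ?thesis using that k by blast
qed

lemma start_locate_unique:
  assumes "start h p k \<le> i" "i < start h p (Suc k)" "start h p l \<le> i" "i < start h p (Suc l)"
  shows "k = l"
proof (rule ccontr)
  assume "k \<noteq> l"
  then have "Suc k \<le> l \<or> Suc l \<le> k" by linarith
  then show False using start_mono[of "Suc k" l h p] start_mono[of "Suc l" k h p] assms by linarith
qed

lemma card_Ter_occurrences: "card {k. k < length p \<and> (\<exists>c. p ! k = Ter c)} = length (erase_vars p)"
proof -
  have "length (filter (\<lambda>s. \<exists>c. s = Ter c) p) = length (erase_vars p)"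
  proof (induction p)
    case (Cons s p)
    then show ?case by (cases s) auto
  qed simp
  then show ?thesis by (simp add: length_filter_conv_card)
qed

text \<open>Pigeonhole: the letters of \<open>p\<close> occupy only
  \<open>length (erase_vars p)\<close> positions, too few to fill \<open>n\<close> consecutive
  ones.\<close>

lemma long_range_meets_variable:
  assumes "length (erase_vars p) < n" "i + n \<le> length (subst h p)"
  obtains k x r where "k < length p" "p ! k = Var x" "r < length (h x)"
    "i \<le> start h p k + r" "start h p k + r < i + n"
proof -
  let ?O = "{k. k < length p \<and> (\<exists>c. p ! k = Ter c)}"
  have "\<not> {i..<i + n} \<subseteq> start h p ` ?O"
  proof
    assume "{i..<i + n} \<subseteq> start h p ` ?O"
    then have "card {i..<i + n} \<le> card ?O" by (intro surj_card_le) auto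
    then show False using assms card_Ter_occurrences[of p] by simp
  qed
  then obtain j where j: "i \<le> j" "j < i + n" "j \<notin> start h p ` ?O"
    by (meson atLeastLessThan_iff subsetI)
  then obtain k where k: "k < length p" "start h p k \<le> j" "j < start h p (Suc k)"
    using start_locate[of j h p] assms by auto
  show ?thesis
  proof (cases "p ! k")
    case (Var x)
    show ?thesis
      by (rule that[of k x "j - start h p k"]) (use k j Var start_Suc[of k p h] in auto)
  next
    case (Ter c)
    then have "j = start h p k" using k start_Suc[of k p h] by simp
    then show ?thesis using j Ter k by auto
  qed
qed

lemma card_Var_occurrences:
  assumes "quasi_regular m p" "X \<subseteq> vars p"
  shows "card {k. k < length p \<and> (\<exists>x\<in>X. p ! k = Var x)} = m * card X"
proof -
  have fin: "finite X" using assms finite_subset finite_vars by blast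
  have "{k. k < length p \<and> (\<exists>x\<in>X. p ! k = Var x)} = (\<Union>x\<in>X. {k. k < length p \<and> p ! k = Var x})" by auto
  also have "card \<dots> = (\<Sum>x\<in>X. card {k. k < length p \<and> p ! k = Var x})"
    by (rule card_UN_disjoint) (use fin in auto)
  also have "\<dots> = (\<Sum>x\<in>X. m)"
    using assms by (intro sum.cong) (auto simp: card_occurrences quasi_regular_def)
  finally show ?thesis by simp
qed

lemma followed_iff_nth:
  "followed y z p \<longleftrightarrow> (\<forall>k < length p. p ! k = Var y \<longrightarrow> Suc k < length p \<and> p ! Suc k = Var z)"
proof (induction p)
  case (Cons s p)
  have "(\<exists>p'. p = Var z # p') \<longleftrightarrow> 0 < length p \<and> p ! 0 = Var z" by (cases p) auto
  then show ?case using Cons by (simp add: All_less_Suc2)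
qed simp

text \<open>The word \<open>subst g p = subst h q\<close> carries the cuts of both patterns. Since a block
  \<open>a b\<^sup>N a\<close> with \<open>N > e\<close> identifies its variable of \<open>p\<close>, a block that lies inside
  the image of an occurrence of \<open>x\<close> reappears at the same offset in every occurrence of \<open>x\<close>.\<close>

locale block_factorization =
  fixes m e :: nat and a b :: 'a and p q :: "'a pattern" and g h :: "nat \<Rightarrow> 'a list"
  assumes m: "m \<ge> 1" and ab: "a \<noteq> b"
    and p: "quasi_regular m p" "length (erase_vars p) = e"
    and q: "quasi_regular m q" "length (erase_vars q) = e"
    and g: "g = (\<lambda>y. a # replicate (e + 1 + y) b @ [a])"
    and eq: "subst g p = subst h q"
begin

lemma length_g: "length (g y) = e + 3 + y"
  by (simp add: g)

lemma g_nth: "g y ! 0 = a" "g y ! (e + 2 + y) = a" "0 < r \<Longrightarrow> r < e + 2 + y \<Longrightarrow> g y ! r = b"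
  by (auto simp: g nth_Cons nth_append split: nat.splits)

text \<open>The run of \<open>b\<close> is longer than \<open>e\<close>, so it meets the block of
  some variable \<open>z\<close> of \<open>p\<close>. Both runs are enclosed by \<open>a\<close>, so
  they coincide, and the length of the run identifies the variable.\<close>

lemma block_unique:
  assumes i: "i + (e + 3 + y) \<le> length (subst g p)"
    and nth: "\<And>r. r < e + 3 + y \<Longrightarrow> subst g p ! (i + r) = g y ! r"
  obtains k where "k < length p" "p ! k = Var y" "start g p k = i"
proof -
  let ?u = "subst g p"
  \<comment> \<open>The window of length \<open>e + 1 + y\<close> from \<open>i + 1\<close> is
    exactly the run of \<open>b\<close> between the two letters \<open>a\<close>.\<close>
  obtain k z r where k: "k < length p" "p ! k = Var z" "r < length (g z)"
    "i + 1 \<le> start g p k + r" "start g p k + r < i + 1 + (e + 1 + y)"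
    using long_range_meets_variable[of p "e + 1 + y" "i + 1" g] p i by auto
  let ?s = "start g p k"
  have run: "?u ! (?s + t) = g z ! t" if "t < e + 3 + z" for t
    using subst_nth(1)[of k p t g] k that length_g by simp
  have ua: "?u ! i = a" "?u ! (i + (e + 2 + y)) = a" using nth[of 0] nth[of "e + 2 + y"] g_nth by auto
  have ub: "?u ! j = b" if "i < j" "j < i + (e + 2 + y)" for j
    using nth[of "j - i"] g_nth(3)[of "j - i" y] that by auto
  have sa: "?u ! ?s = a" "?u ! (?s + (e + 2 + z)) = a" using run[of 0] run[of "e + 2 + z"] g_nth by auto
  have sb: "?u ! j = b" if "?s < j" "j < ?s + (e + 2 + z)" for j
    using run[of "j - ?s"] g_nth(3)[of "j - ?s" z] that by auto
  have rr: "r < e + 3 + z" using k(3) length_g by simp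
  have ur: "?u ! (?s + r) = b" using ub k by simp
  have "r \<noteq> 0"
  proof
    assume "r = 0"
    then show False using ur sa(1) ab by simp
  qed
  moreover have "r \<noteq> e + 2 + z"
  proof
    assume "r = e + 2 + z"
    then show False using ur sa(2) ab by simp
  qed
  ultimately have r: "0 < r" "r < e + 2 + z" using rr by linarith+
  have "i = ?s"
  proof (rule ccontr)
    assume "i \<noteq> ?s"
    then consider "i < ?s" | "?s < i" by linarith
    then show False
    proof cases
      case 1
      then show False using ub[of ?s] sa ab k r by auto
    next
      case 2
      then show False using sb[of i] ua ab k r by auto
    qed
  qed
  moreover have "y = z"
  proof (rule ccontr)
    assume "y \<noteq> z"
    then consider "y < z" | "z < y" by linarith
    then show False
    proof cases
      case 1
      then show False using sb[of "i + (e + 2 + y)"] ua ab calculation by auto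
    next
      case 2
      then show False using ub[of "?s + (e + 2 + z)"] sa ab calculation by auto
    qed
  qed
  ultimately show ?thesis using that k by blast
qed

text \<open>A single pair of occurrences is asked for; \<open>inside_at_q\<close> and
  \<open>inside_at_p\<close> extend this to all occurrences of \<open>x\<close> and of
  \<open>y\<close>, with the same offset \<open>d\<close>.\<close>

definition inside :: "nat \<Rightarrow> nat \<Rightarrow> nat \<Rightarrow> bool" where
  "inside y x d \<longleftrightarrow> (\<exists>k < length p. \<exists>l < length q. p ! k = Var y \<and> q ! l = Var x \<and>
     start g p k = start h q l + d \<and> d + length (g y) \<le> length (h x))"

lemma inside_length: "inside y x d \<Longrightarrow> d + length (g y) \<le> length (h x)"
  by (auto simp: inside_def)

text \<open>All occurrences of \<open>x\<close> have the same image, so each carries a copy of the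
  block at offset \<open>d\<close>, and \<open>block_unique\<close> recognises the copy as an image
  of \<open>y\<close>.\<close>

lemma inside_at_q:
  assumes "inside y x d" "l' < length q" "q ! l' = Var x"
  obtains k' where "k' < length p" "p ! k' = Var y" "start g p k' = start h q l' + d"
proof -
  obtain k l where k: "k < length p" "p ! k = Var y" and l: "l < length q" "q ! l = Var x"
    and s: "start g p k = start h q l + d" and d: "d + length (g y) \<le> length (h x)"
    using assms by (auto simp: inside_def)
  have nth: "subst g p ! (start h q l' + d + r) = g y ! r" if "r < e + 3 + y" for r
  proof -
    have r: "d + r < length (h x)" "r < length (g y)" using d that length_g[of y] by linarith+
    have "subst h q ! (start h q l' + (d + r)) = h x ! (d + r)"
      using subst_nth(1)[of l' q "d + r" h] assms r by simp
    also have "\<dots> = subst h q ! (start h q l + (d + r))"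
      using subst_nth(1)[of l q "d + r" h] l r by simp
    also have "\<dots> = subst g p ! (start g p k + r)" by (simp add: eq s add.assoc)
    also have "\<dots> = g y ! r" using subst_nth(1)[of k p r g] k r by simp
    finally show ?thesis by (simp add: eq add.assoc)
  qed
  have "start h q l' + (d + (e + 2 + y)) < length (subst h q)"
    using subst_nth(2)[of l' q "d + (e + 2 + y)" h] assms d length_g[of y] by simp
  then have "start h q l' + d + (e + 3 + y) \<le> length (subst g p)" by (simp add: eq)
  from block_unique[OF this nth] show ?thesis using that by blast
qed

text \<open>\<open>inside_at_q\<close> maps the occurrences of \<open>x\<close> injectively to those
  of \<open>y\<close>. There are \<open>m\<close> of either kind, so the map is onto.\<close>

lemma inside_at_p:
  assumes "inside y x d" "k' < length p" "p ! k' = Var y"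
  obtains l' where "l' < length q" "q ! l' = Var x" "start g p k' = start h q l' + d"
proof -
  let ?A = "{k. k < length p \<and> p ! k = Var y}" and ?B = "{l. l < length q \<and> q ! l = Var x}"
  have "\<forall>l\<in>?B. \<exists>k. k \<in> ?A \<and> start g p k = start h q l + d"
    using inside_at_q[OF assms(1)] by blast
  then obtain f where f: "\<forall>l\<in>?B. f l \<in> ?A \<and> start g p (f l) = start h q l + d"
    by (rule bchoice[THEN exE])
  \<comment> \<open>A nonempty image makes distinct occurrences of \<open>x\<close> start at
    distinct positions.\<close>
  have d: "0 < length (h x)" using inside_length[OF assms(1)] length_g[of y] by linarith
  have "inj_on f ?B"
  proof (rule inj_onI)
    fix l l' assume *: "l \<in> ?B" "l' \<in> ?B" "f l = f l'"
    then have "start h q l = start h q l'" using f by (metis add_right_cancel)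
    then show "l = l'"
      using start_locate_unique[of h q l "start h q l" l'] * d start_Suc[of l q h] start_Suc[of l' q h] by simp
  qed
  then have "card (f ` ?B) = card ?B" by (rule card_image)
  moreover have "x \<in> vars q" "y \<in> vars p"
    using assms by (auto simp: inside_def vars_def in_set_conv_nth)
  then have "card ?B = m" "card ?A = m"
    using p q by (auto simp: card_occurrences quasi_regular_def)
  ultimately have "f ` ?B = ?A" using f by (intro card_subset_eq) auto
  then obtain l' where "l' \<in> ?B" "f l' = k'" using assms by (metis (mono_tags, lifting) imageE mem_Collect_eq)
  then show ?thesis using that f by blast
qed

lemma inside_vars: "inside y x d \<Longrightarrow> x \<in> vars q \<and> y \<in> vars p"
  unfolding inside_def vars_def by (metis mem_Collect_eq nth_mem)

lemma occurrence: "y \<in> vars p \<Longrightarrow> \<exists>k < length p. p ! k = Var y"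
  by (auto simp: vars_def in_set_conv_nth)

lemma inside_same_offset:
  assumes "inside y x d" "inside y' x d"
  shows "y = y'"
proof -
  obtain l where l: "l < length q" "q ! l = Var x" using assms by (auto simp: inside_def)
  obtain k where k: "k < length p" "p ! k = Var y" "start g p k = start h q l + d"
    using inside_at_q[OF assms(1) l] .
  obtain k' where k': "k' < length p" "p ! k' = Var y'" "start g p k' = start h q l + d"
    using inside_at_q[OF assms(2) l] .
  have "k = k'"
    using start_locate_unique[of g p k "start g p k" k'] k k' start_Suc[of k p g] start_Suc[of k' p g]
      length_g by simp
  then show ?thesis using k k' by simp
qed

definition good :: "nat set" where "good = {y. \<exists>x d. inside y x d}"

text \<open>Double counting: each of the \<open>m\<close> blocks of a bad variable has an end point
  of a variable image of \<open>q\<close> strictly inside it. Blocks are disjoint, and there are at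
  most \<open>2 * m * card (vars q)\<close> such end points.\<close>

lemma card_bad: "card (vars p - good) \<le> 2 * card (vars q)"
proof -
  let ?B = "vars p - good"
  let ?O = "{k. k < length p \<and> (\<exists>y\<in>?B. p ! k = Var y)}"
  let ?V = "{l. l < length q \<and> (\<exists>x\<in>vars q. q ! l = Var x)}"
  let ?C = "start h q ` ?V \<union> (start h q \<circ> Suc) ` ?V"
  have "\<forall>k\<in>?O. \<exists>c. c \<in> ?C \<and> start g p k < c \<and> c < start g p (Suc k)"
  proof
    fix k assume "k \<in> ?O"
    then obtain y where k: "k < length p" "p ! k = Var y" "y \<notin> good" by auto
    let ?s = "start g p k"
    have sS: "start g p (Suc k) = ?s + (e + 3 + y)" using start_Suc[of k p g] k length_g by simp
    have "?s + (e + 3 + y) \<le> length (subst h q)"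
      using start_mono[of "Suc k" "length p" g p] k by (simp add: sS flip: eq)
    then obtain l x r where l: "l < length q" "q ! l = Var x" "r < length (h x)"
      "?s \<le> start h q l + r" "start h q l + r < ?s + (e + 3 + y)"
      using long_range_meets_variable[of q "e + 3 + y" ?s h] q by auto
    have "Var x \<in> set q" using l nth_mem by fastforce
    then have lV: "l \<in> ?V" using l by (simp add: vars_def)
    have lS: "start h q (Suc l) = start h q l + length (h x)" using start_Suc[of l q h] l by simp
    \<comment> \<open>The block meets the image of \<open>x\<close>. If neither end point of that
      image fell strictly inside the block, the image would contain the block and \<open>y\<close>
      would be good.\<close>
    have "?s < start h q l \<or> start h q (Suc l) < ?s + (e + 3 + y)"
    proof (rule ccontr)
      assume "\<not> ?thesis"
      then have "inside y x (?s - start h q l)"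
        unfolding inside_def using k l lS length_g[of y] by (intro exI[of _ k] exI[of _ l]) auto
      then show False using k by (auto simp: good_def)
    qed
    then show "\<exists>c. c \<in> ?C \<and> start g p k < c \<and> c < start g p (Suc k)"
    proof
      assume "?s < start h q l"
      then show ?thesis using lV l sS by (intro exI[of _ "start h q l"] conjI UnI1 imageI) simp_all
    next
      assume "start h q (Suc l) < ?s + (e + 3 + y)"
      moreover have "start h q (Suc l) \<in> (start h q \<circ> Suc) ` ?V" using imageI[OF lV, of "start h q \<circ> Suc"] by simp
      ultimately show ?thesis using l sS lS by (intro exI[of _ "start h q (Suc l)"] conjI UnI2) simp_all
    qed
  qed
  then obtain f where f: "\<forall>k\<in>?O. f k \<in> ?C \<and> start g p k < f k \<and> f k < start g p (Suc k)"
    by (rule bchoice[THEN exE])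
  have "inj_on f ?O"
  proof (rule inj_onI)
    fix k k' assume *: "k \<in> ?O" "k' \<in> ?O" "f k = f k'"
    have "start g p k < f k" "f k < start g p (Suc k)" using f *(1) by blast+
    moreover have "start g p k' < f k'" "f k' < start g p (Suc k')" using f *(2) by blast+
    ultimately show "k = k'" using *(3) start_locate_unique[of g p k "f k" k'] by simp
  qed
  moreover have "f ` ?O \<subseteq> ?C" using f by blast
  ultimately have "card ?O \<le> card ?C" by (intro card_inj_on_le) auto
  also have "\<dots> \<le> card (start h q ` ?V) + card ((start h q \<circ> Suc) ` ?V)" by (rule card_Un_le)
  also have "\<dots> \<le> card ?V + card ?V" by (intro add_mono card_image_le) auto
  finally have "m * card ?B \<le> m * card (vars q) + m * card (vars q)"
    using card_Var_occurrences[OF p(1), of ?B] card_Var_occurrences[OF q(1), of "vars q"] by auto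
  then have "m * card ?B \<le> m * (2 * card (vars q))" by (simp only: mult_2 distrib_left)
  then show ?thesis using m by (subst (asm) mult_le_cancel1) simp
qed

text \<open>Among the variables of \<open>p\<close> whose blocks lie inside \<open>x\<close>, consecutive ones are parallel
  unless a letter separates them somewhere.\<close>

lemma good_next:
  assumes red: "successors p = {}" and y: "inside y x d" "inside y' x d'" "d < d'"
  obtains k c where "Suc k < length p" "p ! k = Var y" "p ! Suc k = Ter c"
proof -
  \<comment> \<open>\<open>D\<close> is the offset of the next block after \<open>d\<close> inside
    the image of \<open>x\<close>, and \<open>z\<close> its variable.\<close>
  define D where "D = (LEAST d'. d < d' \<and> (\<exists>z. inside z x d'))"
  have D: "d < D \<and> (\<exists>z. inside z x D)" unfolding D_def by (rule LeastI[of _ d']) (use y in blast)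
  then obtain z where z: "d < D" "inside z x D" by blast
  have least: "D \<le> d''" if "d < d''" "inside z' x d''" for d'' z'
    unfolding D_def by (rule Least_le) (use that in blast)
  have "y \<in> vars p" using y inside_vars by blast
  \<comment> \<open>Reducedness supplies an occurrence of \<open>y\<close> without \<open>z\<close>
    right behind it, although the block of \<open>z\<close> starts further on in the same image of
    \<open>x\<close>.\<close>
  then have "\<not> followed y z p" using red by (auto simp: successors_def)
  then obtain k where k: "k < length p" "p ! k = Var y" "\<not> (Suc k < length p \<and> p ! Suc k = Var z)"
    by (auto simp: followed_iff_nth)
  obtain l where l: "l < length q" "q ! l = Var x" "start g p k = start h q l + d"
    using inside_at_p[OF y(1) k(1,2)] .
  obtain k' where k': "k' < length p" "p ! k' = Var z" "start g p k' = start h q l + D"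
    using inside_at_q[OF z(2) l(1,2)] .
  have kk': "k < k'"
  proof (rule ccontr)
    assume "\<not> k < k'"
    then show False using start_mono[of k' k g p] l k' z by simp
  qed
  then have "Suc k \<noteq> k'" using k k' by auto
  then have S: "Suc k < k'" "Suc k < length p" using kk' k' by linarith+
  show ?thesis
  proof (cases "p ! Suc k")
    case (Ter c)
    then show ?thesis using that S k by blast
  next
    case (Var v)
    let ?s = "start g p (Suc k)"
    have s1: "?s = start h q l + d + length (g y)" using start_Suc[of k p g] k l by simp
    have "?s + length (g v) = start g p (Suc (Suc k))" using start_Suc[of "Suc k" p g] S Var by simp
    also have "\<dots> \<le> start g p k'" using S by (intro start_mono) simp
    finally have s2: "?s + length (g v) \<le> start h q l + D" using k' by simp
    have s3: "D \<le> length (h x)" using inside_length[OF z(2)] by simp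
    \<comment> \<open>A variable right behind \<open>y\<close> would have its block inside
      \<open>x\<close> at an offset strictly between \<open>d\<close> and \<open>D\<close>, against
      the choice of \<open>D\<close>.\<close>
    have "inside v x (d + length (g y))"
      unfolding inside_def using S Var l s1 s2 s3 by (intro exI[of _ "Suc k"] exI[of _ l]) auto
    then have "D \<le> d + length (g y)" using least length_g[of y] by simp
    then show ?thesis using s1 s2 length_g[of v] by simp
  qed
qed

text \<open>At most \<open>e\<close> variables are somewhere followed by a letter (the set
  \<open>S\<close>). Each \<open>x\<close> hosts at most one good variable outside \<open>S\<close>,
  since of two with different offsets the earlier one lies in \<open>S\<close> by
  \<open>good_next\<close>.\<close>

lemma card_good:
  assumes red: "successors p = {}"
  shows "card good \<le> card (vars q) + e"
proof -
  define S where "S = {y. \<exists>k c. Suc k < length p \<and> p ! k = Var y \<and> p ! Suc k = Ter c}"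
  let ?T = "{k. k < length p \<and> (\<exists>c. p ! k = Ter c)}"
  have fin: "finite good"
    by (rule finite_subset[of _ "vars p"]) (use inside_vars in \<open>auto simp: good_def\<close>)
  have "\<forall>y\<in>good - S. \<exists>x. \<exists>d. inside y x d" by (auto simp: good_def)
  then obtain f where f: "\<forall>y\<in>good - S. \<exists>d. inside y (f y) d"
    by (rule bchoice[THEN exE])
  have "inj_on f (good - S)"
  proof (rule inj_onI)
    fix y y' assume *: "y \<in> good - S" "y' \<in> good - S" "f y = f y'"
    then obtain d d' where d: "inside y (f y) d" "inside y' (f y) d'" using f by metis
    consider "d < d'" | "d' < d" | "d = d'" by linarith
    then show "y = y'"
    proof cases
      case 1
      then show ?thesis using good_next[OF red d] * by (auto simp: S_def)
    next
      case 2
      then show ?thesis using good_next[OF red d(2,1)] * by (auto simp: S_def)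
    next
      case 3
      then show ?thesis using inside_same_offset d by blast
    qed
  qed
  moreover have "f ` (good - S) \<subseteq> vars q" using f inside_vars by blast
  ultimately have 1: "card (good - S) \<le> card (vars q)" by (intro card_inj_on_le) auto
  have "\<forall>y\<in>S. \<exists>k. p ! k = Var y \<and> Suc k \<in> ?T" by (auto simp: S_def)
  then obtain f' where f': "\<forall>y\<in>S. p ! f' y = Var y \<and> Suc (f' y) \<in> ?T" by (rule bchoice[THEN exE])
  have "inj_on (Suc \<circ> f') S"
  proof (rule inj_onI)
    fix y y' assume "y \<in> S" "y' \<in> S" "(Suc \<circ> f') y = (Suc \<circ> f') y'"
    then show "y = y'" using f' by (metis comp_apply nat.inject sym.inject(1))
  qed
  then have "card S \<le> card ?T" by (rule card_inj_on_le) (use f' in auto)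
  then have 2: "card S \<le> e" using p card_Ter_occurrences by metis
  have "S \<subseteq> vars p"
  proof
    fix y assume "y \<in> S"
    then obtain k where "k < length p" "p ! k = Var y" by (auto simp: S_def dest: Suc_lessD)
    then show "y \<in> vars p" unfolding vars_def using nth_mem[of k p] by simp
  qed
  then have "finite S" using finite_vars by (rule finite_subset)
  then have "card good \<le> card ((good - S) \<union> S)" using fin by (intro card_mono) auto
  also have "\<dots> \<le> card (good - S) + card S" by (rule card_Un_le)
  finally show ?thesis using 1 2 by linarith
qed

lemma card_vars_le:
  assumes "successors p = {}"
  shows "card (vars p) \<le> 3 * card (vars q) + e"
proof -
  have "card (vars p) \<le> card (vars p - good) + card good"
  proof -
    have "finite good"
      by (rule finite_subset[of _ "vars p"]) (use inside_vars in \<open>auto simp: good_def\<close>)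
    then have "card (vars p) \<le> card ((vars p - good) \<union> good)" by (intro card_mono) auto
    then show ?thesis using card_Un_le le_trans by blast
  qed
  then show ?thesis using card_bad card_good[OF assms] by linarith
qed

end

text \<open>Used contrapositively: a reduced pattern with more variables has a word outside
  \<open>lang q\<close>, namely its image under the block substitution built from \<open>a\<close>
  and \<open>b\<close>.\<close>

lemma card_vars_reduced_le:
  fixes p q :: "'a pattern"
  assumes "m \<ge> 1" "(a :: 'a) \<noteq> b" "quasi_regular m p" "quasi_regular m q"
    "length (erase_vars p) = length (erase_vars q)" "lang p \<subseteq> lang q" "successors p = {}"
  shows "card (vars p) \<le> 3 * card (vars q) + length (erase_vars q)"
proof -
  define g where "g = (\<lambda>y. a # replicate (length (erase_vars q) + 1 + y) b @ [a])"
  obtain h where "subst g p = subst h q"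
    using assms(6) subst_in_lang[of g p] by (auto simp: lang_def)
  then interpret block_factorization m "length (erase_vars q)" a b p q g h
    using assms by unfold_locales (auto simp: g_def)
  show ?thesis using card_vars_le assms by simp
qed


text \<open>For the target \<open>q\<close>, the small \<open>r\<close> stands in for an arbitrary
  rival \<open>p\<close>: it has the same language, or a word outside \<open>lang q\<close> that
  also belongs to \<open>lang p\<close>.\<close>

lemma exists_small_witness:
  fixes p q :: "'a pattern"
  assumes "m \<ge> 1" "(a :: 'a) \<noteq> b" "quasi_regular m p" "quasi_regular m q" "erase_vars p = erase_vars q"
  shows "\<exists>r. subpattern r p \<and> (lang r = lang p \<or> \<not> lang r \<subseteq> lang q) \<and>
    card (vars r) \<le> (if vars q = {} then 1 else 3 * card (vars q) + length (erase_vars q) + m + 1)"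
proof (cases "vars q = {}")
  case True
  show ?thesis
  proof (cases "vars p = {}")
    case False
    then obtain y where y: "y \<in> vars p" by blast
    \<comment> \<open>Keeping one variable already yields a word longer than all words of
      \<open>lang q\<close>.\<close>
    define r where "r = filter (\<lambda>s. s \<notin> Var ` (- {y})) p"
    have r: "subpattern r p" by (auto simp: r_def subpattern_def)
    have vr: "vars r = {y}" unfolding r_def vars_filter using y by auto
    have "length (subst (\<lambda>_. [a]) r) > length (erase_vars q)"
      using length_subst_quasi_regular[OF subpattern_quasi_regular[OF r assms(3)]] assms vr
        subpattern_erase_vars[OF r] by simp
    moreover have "length u = length (erase_vars q)" if "u \<in> lang q" for u
      using that True by (auto simp: lang_def length_subst)
    ultimately have "subst (\<lambda>_. [a]) r \<notin> lang q" by fastforce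
    then have "\<not> lang r \<subseteq> lang q" using subst_in_lang[of "\<lambda>_. [a]" r] by (meson subsetD)
    then show ?thesis using r vr True by (intro exI[of _ r]) simp
  next
    case empty: True
    show ?thesis using True empty by (intro exI[of _ p]) simp
  qed
next
  case False
  let ?R = "3 * card (vars q) + length (erase_vars q)"
  obtain r where r: "subpattern r p" "lang r = lang p" "successors r = {}"
    using exists_reduced_subpattern[OF assms(3)] by blast
  show ?thesis
  proof (cases "card (vars r) \<le> ?R")
    case True
    then show ?thesis using r False by (intro exI[of _ r]) simp
  next
    case gt: False
    have rq: "quasi_regular m r" using subpattern_quasi_regular r assms by blast
    obtain s where s: "subpattern s r" "successors s = {}" "?R < card (vars s)" "card (vars s) \<le> ?R + m + 1"
      using exists_reduced_subpattern_bounded[OF rq r(3), of ?R] gt by auto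
    have sp: "subpattern s p" using s r subpattern_trans by blast
    have "\<not> lang s \<subseteq> lang q"
    proof
      assume "lang s \<subseteq> lang q"
      then have "card (vars s) \<le> ?R"
        using card_vars_reduced_le[OF assms(1,2) subpattern_quasi_regular[OF sp assms(3)] assms(4)]
          subpattern_erase_vars[OF sp] assms(5) s(2) by simp
      then show False using s(3) by simp
    qed
    then show ?thesis using sp s(4) False by (intro exI[of _ s]) simp
  qed
qed

section \<open>Counting pattern languages\<close>

text \<open>Only the multiplicities in \<open>vs\<close> matter; a list allows inserting the
  variables one at a time by induction.\<close>

definition arrangements :: "'a list \<Rightarrow> nat list \<Rightarrow> 'a pattern set" where
  "arrangements w vs = {p. erase_vars p = w \<and> (\<forall>x. count_list p (Var x) = count_list vs x)}"

lemma eq_map_Ter_erase_vars: "vars p = {} \<Longrightarrow> p = map Ter (erase_vars p)"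
proof (induction p)
  case (Cons s p)
  then show ?case by (cases s) auto
qed simp

lemma length_arrangement:
  assumes "p \<in> arrangements w vs"
  shows "length p = length w + length vs"
  using assms
proof (induction vs arbitrary: p)
  case Nil
  then have "vars p = {}" by (auto simp: arrangements_def vars_def count_list_0_iff)
  then have "p = map Ter w" using Nil eq_map_Ter_erase_vars[of p] by (simp add: arrangements_def)
  then show ?case by simp
next
  case (Cons v vs)
  then have "count_list p (Var v) \<noteq> 0" by (simp add: arrangements_def)
  then obtain p1 p2 where p: "p = p1 @ Var v # p2" by (metis count_list_0_iff split_list)
  then have "p1 @ p2 \<in> arrangements w vs" using Cons.prems
    by (auto simp: arrangements_def split: if_splits)
  then show ?case using Cons.IH p by fastforce
qed

text \<open>Inserting one more variable symbol leaves \<open>length w + length vs + 1\<close>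
  choices of position.\<close>

lemma card_arrangements:
  "finite (arrangements w vs) \<and> card (arrangements w vs) \<le> (length w + length vs) ^ length vs"
proof (induction vs)
  case Nil
  have "arrangements w [] \<subseteq> {map Ter w}"
  proof
    fix p assume p: "p \<in> arrangements w []"
    then have "vars p = {}" by (auto simp: arrangements_def vars_def count_list_0_iff)
    then show "p \<in> {map Ter w}" using p eq_map_Ter_erase_vars[of p] by (simp add: arrangements_def)
  qed
  then show ?case using card_mono[of "{map Ter w}"] finite_subset by fastforce
next
  case (Cons v vs)
  let ?n = "length w + length vs"
  let ?A = "arrangements w vs \<times> {..?n}"
  let ?f = "\<lambda>(p, i). take i p @ Var v # drop i p"
  have sub: "arrangements w (v # vs) \<subseteq> ?f ` ?A"
  proof
    fix p assume a: "p \<in> arrangements w (v # vs)"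
    then have "count_list p (Var v) \<noteq> 0" by (simp add: arrangements_def)
    then obtain p1 p2 where p: "p = p1 @ Var v # p2" by (metis count_list_0_iff split_list)
    then have r: "p1 @ p2 \<in> arrangements w vs" using a
      by (auto simp: arrangements_def split: if_splits)
    then have "length p1 \<le> ?n" using length_arrangement by fastforce
    then have "(p1 @ p2, length p1) \<in> ?A" using r by simp
    moreover have "p = ?f (p1 @ p2, length p1)" using p by simp
    ultimately show "p \<in> ?f ` ?A" by blast
  qed
  have fin: "finite ?A" using Cons by simp
  have "card (arrangements w (v # vs)) \<le> card ?A"
    using fin sub by (rule surj_card_le)
  also have "\<dots> = card (arrangements w vs) * Suc ?n" by (simp add: card_cartesian_product)
  also have "\<dots> \<le> ?n ^ length vs * Suc ?n" using Cons by (intro mult_right_mono) auto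
  also have "\<dots> \<le> Suc ?n ^ length vs * Suc ?n" by (intro mult_right_mono power_mono) auto
  finally show ?case using finite_subset[OF sub] fin by (simp add: mult.commute)
qed

section \<open>Normalising the names of variables\<close>

fun var_list :: "nat \<Rightarrow> nat \<Rightarrow> nat list" where
  "var_list m 0 = []"
| "var_list m (Suc k) = replicate m k @ var_list m k"

lemma length_var_list [simp]: "length (var_list m k) = k * m"
  by (induction k) auto

lemma count_list_replicate: "count_list (replicate n x) y = (if x = y then n else 0)"
  by (induction n) auto

lemma count_list_var_list: "count_list (var_list m k) x = (if x < k then m else 0)"
  by (induction k) (auto simp: count_list_replicate)

definition rename :: "(nat \<Rightarrow> nat) \<Rightarrow> 'a pattern \<Rightarrow> 'a pattern" where
  "rename f p = map (\<lambda>s. case s of Var x \<Rightarrow> Var (f x) | Ter c \<Rightarrow> Ter c) p"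

lemma rename_simps [simp]:
  "rename f [] = []"
  "rename f (Var x # p) = Var (f x) # rename f p"
  "rename f (Ter c # p) = Ter c # rename f p"
  by (simp_all add: rename_def)

lemma subst_rename: "subst h (rename f p) = subst (h \<circ> f) p"
proof (induction p)
  case (Cons s p)
  then show ?case by (cases s) auto
qed simp

lemma erase_vars_rename: "erase_vars (rename f p) = erase_vars p"
proof (induction p)
  case (Cons s p)
  then show ?case by (cases s) auto
qed simp

lemma lang_rename:
  assumes "inj_on f (vars p)"
  shows "lang (rename f p) = lang p"
proof
  show "lang (rename f p) \<subseteq> lang p" by (auto simp: lang_def subst_rename)
  show "lang p \<subseteq> lang (rename f p)"
  proof
    fix u assume "u \<in> lang p"
    then obtain h where u: "u = subst h p" by (auto simp: lang_def)
    have "subst (h \<circ> inv_into (vars p) f) (rename f p) = subst h p"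
      unfolding subst_rename by (rule subst_cong) (use assms in simp)
    then show "u \<in> lang (rename f p)"
      using u subst_in_lang[of "h \<circ> inv_into (vars p) f" "rename f p"] by simp
  qed
qed

lemma count_list_rename:
  assumes "inj_on f (insert x (vars p))"
  shows "count_list (rename f p) (Var (f x)) = count_list p (Var x)"
  using assms
proof (induction p)
  case (Cons s p)
  then show ?case by (cases s) (auto simp: insert_commute)
qed simp

lemma count_list_rename_other:
  assumes "y \<notin> f ` vars p"
  shows "count_list (rename f p) (Var y) = 0"
  using assms
proof (induction p)
  case (Cons s p)
  then show ?case by (cases s) auto
qed simp

text \<open>Ranges over all quasi-regular symbol lists, \<open>[]\<close> included, so that the
  languages of subpatterns are covered.\<close>

definition langs :: "nat \<Rightarrow> 'a list \<Rightarrow> nat \<Rightarrow> 'a list set set" where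
  "langs m w K = {lang p | p. quasi_regular m p \<and> erase_vars p = w \<and> card (vars p) \<le> K}"

text \<open>Injective renaming preserves the language, so the variables may be taken to be the first
  \<open>k\<close> numbers, each occurring \<open>m\<close> times.\<close>

lemma langs_subset: "langs m w K \<subseteq> (\<Union>k\<le>K. lang ` arrangements w (var_list m k))"
proof
  fix M assume "M \<in> langs m w K"
  then obtain p where p: "M = lang p" "quasi_regular m p" "erase_vars p = w" "card (vars p) \<le> K"
    by (auto simp: langs_def)
  obtain f where f: "bij_betw f (vars p) {..<card (vars p)}"
    using finite_same_card_bij[of "vars p" "{..<card (vars p)}"] by auto
  then have inj: "inj_on f (vars p)" and img: "f ` vars p = {..<card (vars p)}"
    by (auto simp: bij_betw_def)
  have "count_list (rename f p) (Var y) = count_list (var_list m (card (vars p))) y" for y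
  proof (cases "y < card (vars p)")
    case True
    then have "y \<in> f ` vars p" using img by simp
    then obtain x where x: "x \<in> vars p" "y = f x" by blast
    then have "count_list (rename f p) (Var y) = m"
      using count_list_rename[of f x p] inj p(2) by (simp add: insert_absorb quasi_regular_def)
    then show ?thesis using True by (simp add: count_list_var_list)
  next
    case False
    then have "y \<notin> f ` vars p" using img by simp
    then show ?thesis using count_list_rename_other False by (simp add: count_list_var_list)
  qed
  then have "rename f p \<in> arrangements w (var_list m (card (vars p)))"
    using p by (simp add: arrangements_def erase_vars_rename)
  then show "M \<in> (\<Union>k\<le>K. lang ` arrangements w (var_list m k))"
    using p(1,4) lang_rename[OF inj] by (intro UN_I[of "card (vars p)"] image_eqI[of _ _ "rename f p"]) simp_all
qed

lemma card_langs:
  assumes "m \<ge> 1" "K \<ge> 1"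
  shows "finite (langs m w K)" "card (langs m w K) \<le> (K + 1) * (length w + K * m) ^ (K * m)"
proof -
  let ?U = "\<Union>k\<le>K. lang ` arrangements w (var_list m k)"
  have fin: "finite ?U" by (simp add: card_arrangements)
  with langs_subset show "finite (langs m w K)" by (rule finite_subset)
  from fin langs_subset have "card (langs m w K) \<le> card ?U" by (rule card_mono)
  also have "\<dots> \<le> (\<Sum>k\<le>K. card (lang ` arrangements w (var_list m k)))"
    by (rule card_UN_le) simp
  also have "\<dots> \<le> (\<Sum>k\<le>K. (length w + K * m) ^ (K * m))"
  proof (rule sum_mono)
    fix k assume "k \<in> {..K}"
    then have k: "k * m \<le> K * m" by simp
    have "card (lang ` arrangements w (var_list m k)) \<le> card (arrangements w (var_list m k))"
      by (rule card_image_le) (simp add: card_arrangements)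
    also have "\<dots> \<le> (length w + k * m) ^ (k * m)" using card_arrangements[of w "var_list m k"] by simp
    also have "\<dots> \<le> (length w + K * m) ^ (k * m)" using k by (intro power_mono) auto
    also have "\<dots> \<le> (length w + K * m) ^ (K * m)"
      using k assms by (intro power_increasing) (auto simp: Suc_le_eq)
    finally show "card (lang ` arrangements w (var_list m k)) \<le> (length w + K * m) ^ (K * m)" .
  qed
  finally show "card (langs m w K) \<le> (K + 1) * (length w + K * m) ^ (K * m)" by simp
qed


section \<open>Teaching sets\<close>

lemma TD_le:
  assumes "finite T" "teaching_set T p \<Pi>"
  shows "\<exists>n. TD p \<Pi> = enat n \<and> n \<le> card T"
proof -
  have "TD p \<Pi> \<le> enat (card T)"
    unfolding TD_def by (rule Inf_lower) (use assms in blast)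
  then show ?thesis by (cases "TD p \<Pi>") auto
qed

lemma teaching_set_exists:
  fixes p :: "'a pattern"
  assumes "m \<ge> 1" "(a :: 'a) \<noteq> b" "p \<in> QR m"
    and K: "K = (if vars p = {} then 1 else 3 * card (vars p) + length (erase_vars p) + m + 1)"
  shows "\<exists>T. finite T \<and> teaching_set T p (QR m) \<and>
    card T \<le> 1 + 2 ^ length (erase_vars p) + card (langs m (erase_vars p) K)"
proof -
  let ?w = "erase_vars p" and ?L = "lang p"
  let ?M = "langs m ?w K"
  have qp: "quasi_regular m p" using assms by (simp add: QR_def)
  have finM: "finite ?M" by (rule card_langs) (use assms in auto)
  \<comment> \<open>The example that separates \<open>M\<close> from the target: positive if
    \<open>M\<close> is properly contained in \<open>?L\<close>, negative if \<open>M\<close> is not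
    contained in it.\<close>
  define ex where "ex M = (if M \<subseteq> ?L then (SOME u. u \<in> ?L - M, True) else (SOME u. u \<in> M - ?L, False))"
    for M :: "'a list set"
  have ex1: "ex M = (fst (ex M), True) \<and> fst (ex M) \<in> ?L - M" if "M \<subseteq> ?L" "M \<noteq> ?L" for M
  proof -
    have "\<exists>u. u \<in> ?L - M" using that by blast
    from someI_ex[OF this] show ?thesis using that by (simp add: ex_def)
  qed
  have ex2: "ex M = (fst (ex M), False) \<and> fst (ex M) \<in> M - ?L" if "\<not> M \<subseteq> ?L" for M
  proof -
    have "\<exists>u. u \<in> M - ?L" using that by blast
    from someI_ex[OF this] show ?thesis using that by (simp add: ex_def)
  qed
  define T1 where "T1 = (\<lambda>u. (u, False)) ` (set (subseqs ?w) - {?w})"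
  define T where "T = insert (?w, True) (T1 \<union> ex ` (?M - {?L}))"
  have "finite T" using finM by (simp add: T_def T1_def)
  moreover have "card T \<le> 1 + 2 ^ length ?w + card ?M"
  proof -
    have "card T1 \<le> card (set (subseqs ?w))"
      unfolding T1_def by (rule order.trans[OF card_image_le]) (auto intro: card_mono)
    also have "\<dots> \<le> 2 ^ length ?w" by (metis card_length length_subseqs)
    finally have 1: "card T1 \<le> 2 ^ length ?w" .
    have 2: "card (ex ` (?M - {?L})) \<le> card ?M"
      by (rule order.trans[OF card_image_le]) (use finM in \<open>auto intro: card_mono\<close>)
    have "card T \<le> Suc (card (T1 \<union> ex ` (?M - {?L})))"
      unfolding T_def by (simp add: card_insert_le_m1)
    then show ?thesis using card_Un_le[of T1 "ex ` (?M - {?L})"] 1 2 by linarith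
  qed
  moreover have "teaching_set T p (QR m)"
    unfolding teaching_set_def
  proof (intro conjI ballI impI)
    \<comment> \<open>Words of the target are at least as long as \<open>?w\<close>, while proper
      subsequences of \<open>?w\<close> are shorter.\<close>
    have neg: "u \<notin> ?L" if "u \<in> set (subseqs ?w)" "u \<noteq> ?w" for u
    proof
      assume "u \<in> ?L"
      then have "length ?w \<le> length u" by (rule length_lang_ge)
      moreover have "subseq u ?w" using that by simp
      ultimately have "u = ?w" by (metis list_emb_length le_antisym subseq_same_length)
      then show False using that by simp
    qed
    have sep: "(fst (ex M) \<in> ?L) = snd (ex M)" if "M \<noteq> ?L" for M
    proof (cases "M \<subseteq> ?L")
      case True
      from ex1[OF True that] have "snd (ex M) = True" "fst (ex M) \<in> ?L" by (metis snd_conv, blast)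
      then show ?thesis by simp
    next
      case False
      from ex2[OF False] have "snd (ex M) = False" "fst (ex M) \<notin> ?L" by (metis snd_conv, blast)
      then show ?thesis by simp
    qed
    have "(u \<in> ?L) = c" if uc: "(u, c) \<in> T" for u c
    proof -
      consider "(u, c) = (?w, True)" | "(u, c) \<in> T1" | M where "(u, c) = ex M" "M \<noteq> ?L"
        using uc unfolding T_def by blast
      then show ?thesis
      proof cases
        case 1
        then show ?thesis using erase_vars_in_lang[of p] by simp
      next
        case 2
        then show ?thesis using neg by (auto simp: T1_def)
      next
        case 3
        then show ?thesis using sep[OF 3(2)] by (metis fst_conv snd_conv)
      qed
    qed
    then show "consistent T p" by (auto simp: consistent_def)
  next
    fix q assume q: "q \<in> QR m" "consistent T q"
    then have qq: "quasi_regular m q" by (simp add: QR_def)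
    have cons: "(u \<in> lang q) = c" if "(u, c) \<in> T" for u c
      using q(2) that by (auto simp: consistent_def)
    have "?w \<in> lang q" using cons[of ?w True] by (simp add: T_def)
    \<comment> \<open>The positive example makes the constant part of \<open>q\<close> a subsequence
      of \<open>?w\<close>; the negative ones exclude the proper subsequences.\<close>
    then have "subseq (erase_vars q) ?w" by (auto simp: lang_def subseq_erase_vars_subst)
    moreover have "(erase_vars q, False) \<notin> T" using cons erase_vars_in_lang by blast
    ultimately have w: "erase_vars q = ?w" by (auto simp: T_def T1_def)
    obtain r where r: "subpattern r q" "lang r = lang q \<or> \<not> lang r \<subseteq> ?L" "card (vars r) \<le> K"
      using exists_small_witness[OF assms(1,2) qq qp w] K by auto
    have rM: "lang r \<in> ?M"
      unfolding langs_def using r subpattern_quasi_regular[OF r(1) qq] subpattern_erase_vars[OF r(1)] w by auto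
    show "lang q = ?L"
    proof (rule ccontr)
      assume ne: "lang q \<noteq> ?L"
      have inT: "ex (lang r) \<in> T" if "lang r \<noteq> ?L" using that rM by (auto simp: T_def)
      show False
      proof (cases "lang r \<subseteq> ?L")
        case True
        \<comment> \<open>Here \<open>r\<close> keeps the whole language of \<open>q\<close>, so the
          positive example outside \<open>lang r\<close> refutes \<open>q\<close>.\<close>
        then have rq: "lang r = lang q" using r(2) by blast
        then have x: "ex (lang r) = (fst (ex (lang r)), True)" "fst (ex (lang r)) \<notin> lang q"
          using ex1[OF True] ne by auto
        have "(fst (ex (lang r)), True) \<in> T" using inT rq ne x(1) by simp
        then show False using cons x(2) by blast
      next
        case False
        \<comment> \<open>The negative example in \<open>lang r\<close> also belongs to
          \<open>lang q\<close>, which refutes \<open>q\<close>.\<close>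
        then have x: "ex (lang r) = (fst (ex (lang r)), False)" "fst (ex (lang r)) \<in> lang q"
          using ex2[OF False] subpattern_lang[OF r(1)] by auto
        have "(fst (ex (lang r)), False) \<in> T" using inT False x(1) by auto
        then show False using cons x(2) by blast
      qed
    qed
  qed
  ultimately show ?thesis by blast
qed

text \<open>The factor \<open>2\<close> comes from \<open>K + 1 \<le> 2 * D\<close>, as
  \<open>1 \<le> K \<le> D\<close>, and from \<open>1 \<le> 2 powr e\<close>, which absorbs the
  single positive example \<open>erase_vars p\<close>.\<close>

lemma TD_bound:
  fixes p :: "'a pattern"
  assumes m: "m \<ge> 1" and ab: "(a :: 'a) \<noteq> b" and p: "p \<in> QR m"
    and e: "e = real (length (erase_vars p))"
    and D: "D \<ge> 1 + (e + real m + 4) * real (card (vars p))"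
  shows "\<exists>n. TD p (QR m) = enat n \<and> real n \<le> 2 * (2 powr e + D * (e + D * real m) powr (D * real m))"
proof -
  let ?w = "erase_vars p" and ?v = "card (vars p)"
  define K where "K = (if vars p = {} then 1 else 3 * ?v + length ?w + m + 1)"
  obtain T where T: "finite T" "teaching_set T p (QR m)" "card T \<le> 1 + 2 ^ length ?w + card (langs m ?w K)"
    using teaching_set_exists[OF m ab p K_def] by blast
  obtain n where n: "TD p (QR m) = enat n" "n \<le> card T" using TD_le[OF T(1,2)] by blast
  have K1: "K \<ge> 1" by (simp add: K_def)
  have KD: "real K \<le> D"
  proof (cases "vars p = {}")
    case True
    then show ?thesis using D by (simp add: K_def)
  next
    case False
    then have v: "real ?v \<ge> 1" by (simp add: Suc_le_eq card_gt_0_iff)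
    have "real K = 3 * real ?v + e + real m + 1" using False by (simp add: K_def e)
    \<comment> \<open>At least one variable occurs, so \<open>e + real m\<close> may be multiplied
      by their number.\<close>
    also have "\<dots> \<le> 1 + 4 * real ?v + (e + real m) * real ?v"
      using mult_left_mono[OF v, of "e + real m"] e by simp
    also have "\<dots> = 1 + (e + real m + 4) * real ?v" by (simp add: algebra_simps)
    finally show ?thesis using D by linarith
  qed
  define B where "B = (e + D * real m) powr (D * real m)"
  have Km: "real K * real m \<le> D * real m" "1 \<le> real K * real m"
    using KD m K1 by (auto simp: mult_right_mono mult_ge1_I)
  have "real ((length ?w + K * m) ^ (K * m)) = (e + real K * real m) powr (real K * real m)"
    using powr_realpow[of "e + real K * real m" "K * m"] Km e by simp
  also have "\<dots> \<le> (e + D * real m) powr (real K * real m)"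
    using Km e by (intro powr_mono2) auto
  also have "\<dots> \<le> B" unfolding B_def using Km e by (intro powr_mono) auto
  finally have B: "real ((length ?w + K * m) ^ (K * m)) \<le> B" .
  have "real (card (langs m ?w K)) \<le> real ((K + 1) * (length ?w + K * m) ^ (K * m))"
    using card_langs(2)[OF m K1, of ?w] of_nat_le_iff by blast
  also have "\<dots> = (real K + 1) * real ((length ?w + K * m) ^ (K * m))" by (simp add: distrib_right)
  also have "\<dots> \<le> (2 * D) * B" using B KD K1 by (intro mult_mono) auto
  finally have L: "real (card (langs m ?w K)) \<le> 2 * (D * B)" by simp
  have "real n \<le> real (1 + 2 ^ length ?w + card (langs m ?w K))" using n T by linarith
  also have "\<dots> = 1 + 2 powr e + real (card (langs m ?w K))" by (simp add: e powr_realpow)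
  also have "\<dots> \<le> 2 * (2 powr e + D * B)"
    using L ge_one_powr_ge_zero[of 2 e] e by (simp add: algebra_simps)
  finally show ?thesis using n(1) unfolding B_def by blast
qed

section \<open>The unary alphabet\<close>

lemma unary_list_eq:
  assumes "card (UNIV :: 'a set) = 1"
  shows "(u :: 'a list) = v \<longleftrightarrow> length u = length v"
proof -
  obtain c :: 'a where "(UNIV :: 'a set) = {c}" using assms by (auto simp: card_1_singleton_iff)
  then have "x = c" for x :: 'a by blast
  then have "w = replicate (length w) c" for w :: "'a list" by (simp add: replicate_length_same)
  then show ?thesis by metis
qed

text \<open>Over one letter a word is its length. A substitution adds \<open>m\<close> times the
  total length of the images, and a single variable realises every multiple of
  \<open>m\<close>.\<close>

lemma unary_lang_iff:
  assumes "card (UNIV :: 'a set) = 1" "quasi_regular m (p :: 'a pattern)"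
  shows "u \<in> lang p \<longleftrightarrow> (\<exists>j. length u = length (erase_vars p) + m * j \<and> (vars p = {} \<longrightarrow> j = 0))"
proof
  assume "u \<in> lang p"
  then obtain h where "u = subst h p" by (auto simp: lang_def)
  then show "\<exists>j. length u = length (erase_vars p) + m * j \<and> (vars p = {} \<longrightarrow> j = 0)"
    using length_subst_quasi_regular[OF assms(2), of h]
    by (intro exI[of _ "\<Sum>x\<in>vars p. length (h x)"]) simp
next
  assume "\<exists>j. length u = length (erase_vars p) + m * j \<and> (vars p = {} \<longrightarrow> j = 0)"
  then obtain j where j: "length u = length (erase_vars p) + m * j" "vars p = {} \<longrightarrow> j = 0" by blast
  show "u \<in> lang p"
  proof (cases "vars p = {}")
    case True
    then have "length (erase_vars p) = length u" using j by simp
    then have "erase_vars p = u" using unary_list_eq[OF assms(1)] by blast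
    then show ?thesis using erase_vars_in_lang by blast
  next
    case False
    then obtain y where y: "y \<in> vars p" by blast
    define h where "h x = (if x = y then replicate j (undefined :: 'a) else [])" for x
    have "(\<Sum>x\<in>vars p. length (h x)) = (\<Sum>x\<in>vars p. if x = y then j else 0)"
      by (rule sum.cong) (auto simp: h_def)
    also have "\<dots> = j" using y by simp
    finally have "length (subst h p) = length u"
      using length_subst_quasi_regular[OF assms(2), of h] j by simp
    then have "subst h p = u" using unary_list_eq[OF assms(1)] by blast
    then show ?thesis using subst_in_lang by blast
  qed
qed

lemma unary_lang_eqI:
  assumes "card (UNIV :: 'a set) = 1" "quasi_regular m (p :: 'a pattern)" "quasi_regular m (q :: 'a pattern)"
    "length (erase_vars p) = length (erase_vars q)" "vars p = {} \<longleftrightarrow> vars q = {}"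
  shows "lang p = lang q"
  using unary_lang_iff[OF assms(1,2)] unary_lang_iff[OF assms(1,3)] assms(4,5) by auto

lemma unary_TD_le:
  assumes z: "card (UNIV :: 'a set) = 1" and m: "m \<ge> 1" and p: "p \<in> (QR m :: 'a pattern set)"
  shows "TD p (QR m) \<le> 3"
proof -
  define e where "e = length (erase_vars p)"
  define w where "w n = replicate n (undefined :: 'a)" for n
  \<comment> \<open>The label at length \<open>e + m\<close> tells whether variables occur; the
    negative example at length \<open>e - m\<close> excludes a shorter constant part.\<close>
  define T where "T = (if vars p = {} then {(w e, True), (w (e + m), False)}
    else {(w e, True), (w (e + m), True)} \<union> (if m \<le> e then {(w (e - m), False)} else {}))"
  have qp: "quasi_regular m p" using p by (simp add: QR_def)
  have w: "w n \<in> lang q \<longleftrightarrow> (\<exists>j. n = length (erase_vars q) + m * j \<and> (vars q = {} \<longrightarrow> j = 0))"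
    if "quasi_regular m q" for n q
    using unary_lang_iff[OF z that] by (simp add: w_def)
  have we: "w e \<in> lang p" unfolding w[OF qp] by (intro exI[of _ 0]) (simp add: e_def)
  have wem: "w (e + m) \<in> lang p \<longleftrightarrow> vars p \<noteq> {}"
  proof
    assume "w (e + m) \<in> lang p"
    then show "vars p \<noteq> {}" using m unfolding w[OF qp] by (auto simp: e_def)
  next
    assume "vars p \<noteq> {}"
    then show "w (e + m) \<in> lang p" unfolding w[OF qp] by (intro exI[of _ 1]) (simp add: e_def)
  qed
  have wme: "w (e - m) \<notin> lang p" if "m \<le> e" using that m unfolding w[OF qp] by (auto simp: e_def)
  have "teaching_set T p (QR m)"
    unfolding teaching_set_def
  proof (intro conjI ballI impI)
    show "consistent T p"
      using we wem wme by (auto simp: consistent_def T_def)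
  next
    fix q :: "'a pattern" assume q: "q \<in> QR m" "consistent T q"
    have qq: "quasi_regular m q" using q by (simp add: QR_def)
    have cons: "(u \<in> lang q) = c" if "(u, c) \<in> T" for u c
      using q(2) that by (auto simp: consistent_def)
    have "w e \<in> lang q" using cons[of "w e" True] by (auto simp: T_def)
    then obtain j where j: "e = length (erase_vars q) + m * j" "vars q = {} \<longrightarrow> j = 0"
      unfolding w[OF qq] by blast
    show "lang q = lang p"
    proof (cases "vars p = {}")
      case True
      then have n: "w (e + m) \<notin> lang q" using cons[of "w (e + m)" False] by (auto simp: T_def)
      have "vars q = {}"
      proof (rule ccontr)
        assume "vars q \<noteq> {}"
        then have "w (e + m) \<in> lang q" unfolding w[OF qq] using j by (intro exI[of _ "Suc j"]) simp
        then show False using n by simp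
      qed
      then show ?thesis using unary_lang_eqI[OF z qq qp] j True by (simp add: e_def)
    next
      case False
      then have "w (e + m) \<in> lang q" using cons[of "w (e + m)" True] by (auto simp: T_def)
      then obtain i where i: "e + m = length (erase_vars q) + m * i" "vars q = {} \<longrightarrow> i = 0"
        unfolding w[OF qq] by blast
      have v: "vars q \<noteq> {}" using i j m by auto
      \<comment> \<open>With a shorter constant part \<open>q\<close> would also generate length
        \<open>e - m\<close>.\<close>
      have "j = 0"
      proof (rule ccontr)
        assume "j \<noteq> 0"
        then obtain j' where j': "j = Suc j'" by (cases j) auto
        then have "m \<le> e" using j by simp
        then have "w (e - m) \<notin> lang q" using cons[of "w (e - m)" False] False by (auto simp: T_def)
        moreover have "w (e - m) \<in> lang q" unfolding w[OF qq] using j j' v by (intro exI[of _ j']) simp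
        ultimately show False by simp
      qed
      then show ?thesis using unary_lang_eqI[OF z qq qp] j v False by (simp add: e_def)
    qed
  qed
  moreover have "finite T" by (simp add: T_def)
  ultimately have "TD p (QR m) \<le> enat (card T)" unfolding TD_def by (intro Inf_lower) blast
  also have "card T \<le> 3"
    by (auto simp: T_def card_insert_if)
  then have "enat (card T) \<le> 3" by (simp add: numeral_eq_enat)
  finally show ?thesis .
qed

lemma teaching_set_separates:
  assumes "teaching_set T p \<Pi>" "q \<in> \<Pi>" "lang q \<noteq> lang p"
  obtains u where "(u, u \<in> lang p) \<in> T" "(u \<in> lang q) \<noteq> (u \<in> lang p)"
proof -
  have "\<not> consistent T q" "consistent T p" using assms by (auto simp: teaching_set_def)
  then obtain u c where u: "(u, c) \<in> T" "(u \<in> lang q) \<noteq> c"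
    unfolding consistent_def by blast
  have "(u \<in> lang p) = c" using \<open>consistent T p\<close> u(1) unfolding consistent_def by blast
  then show ?thesis using that[of u] u by simp
qed

text \<open>The hard pattern is \<open>P m m\<close>, that is \<open>m\<close> letters followed by
  \<open>m\<close> copies of a variable. Separating it from \<open>P 0 m\<close> takes a negative
  example, from \<open>P (2 * m) m\<close> the positive one of length \<open>m\<close>, and from
  \<open>P m 0\<close> a positive one of another length.\<close>

lemma unary_TD_ge:
  assumes z: "card (UNIV :: 'a set) = 1" and m: "m \<ge> 1"
  shows "\<exists>p \<in> (QR m :: 'a pattern set). 3 \<le> TD p (QR m)"
proof -
  define P where "P n k = replicate n (Ter (undefined :: 'a)) @ replicate k (Var 0)" for n k
  have er: "length (erase_vars (P n k)) = n" for n k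
  proof -
    have "erase_vars (replicate k (Var 0)) = ([] :: 'a list)" by (induction k) auto
    moreover have "length (erase_vars (replicate n (Ter (undefined :: 'a)))) = n" by (induction n) auto
    ultimately show ?thesis by (simp add: P_def)
  qed
  have vs: "vars (P n k) = (if k = 0 then {} else {0})" for n k
    by (auto simp: P_def vars_def)
  have QR: "P n m \<in> QR m" "P m 0 \<in> QR m" for n
    using m vs[of n m] vs[of m 0]
    by (auto simp: QR_def is_pattern_def quasi_regular_def P_def count_list_replicate)
  have lang1: "u \<in> lang (P n m) \<longleftrightarrow> (\<exists>j. length u = n + m * j)" for u n
    using unary_lang_iff[OF z, of m "P n m" u] QR(1)[of n] vs[of n m] m by (simp add: QR_def er)
  have lang2: "u \<in> lang (P m 0) \<longleftrightarrow> length u = m" for u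
    using unary_lang_iff[OF z, of m "P m 0" u] QR(2) vs[of m 0] m by (simp add: QR_def er)
  let ?p = "P m m"
  have "3 \<le> card T" if T: "finite T" "teaching_set T ?p (QR m)" for T
  proof -
    have "[] \<in> lang (P 0 m)" "[] \<notin> lang ?p" using m by (auto simp: lang1)
    then have "lang (P 0 m) \<noteq> lang ?p" by blast
    then obtain u where u: "(u, u \<in> lang ?p) \<in> T" "(u \<in> lang (P 0 m)) \<noteq> (u \<in> lang ?p)"
      using teaching_set_separates[OF T(2) QR(1)] by blast
    have u1: "u \<notin> lang ?p"
    proof
      assume "u \<in> lang ?p"
      then obtain j where "length u = m + m * j" by (auto simp: lang1)
      then have "length u = 0 + m * Suc j" by simp
      then have "u \<in> lang (P 0 m)" unfolding lang1 by blast
      then show False using u(2) \<open>u \<in> lang ?p\<close> by simp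
    qed
    have "replicate m undefined \<in> lang ?p" "replicate m undefined \<notin> lang (P (2 * m) m)"
      using m by (auto simp: lang1)
    then have "lang (P (2 * m) m) \<noteq> lang ?p" by blast
    then obtain v where v: "(v, v \<in> lang ?p) \<in> T" "(v \<in> lang (P (2 * m) m)) \<noteq> (v \<in> lang ?p)"
      using teaching_set_separates[OF T(2) QR(1)] by blast
    have v1: "v \<in> lang ?p \<and> length v = m"
    proof -
      have "v \<in> lang (P (2 * m) m) \<Longrightarrow> v \<in> lang ?p"
      proof -
        assume "v \<in> lang (P (2 * m) m)"
        then obtain j where "length v = 2 * m + m * j" by (auto simp: lang1)
        then have "length v = m + m * Suc j" by simp
        then show "v \<in> lang ?p" unfolding lang1 by blast
      qed
      then have 1: "v \<in> lang ?p" "v \<notin> lang (P (2 * m) m)" using v(2) by auto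
      then obtain j where j: "length v = m + m * j" by (auto simp: lang1)
      have "j = 0"
      proof (cases j)
        case (Suc i)
        then have "length v = 2 * m + m * i" using j by simp
        then show ?thesis using 1(2) unfolding lang1 by blast
      qed
      then show ?thesis using 1 j by simp
    qed
    have "replicate (2 * m) undefined \<notin> lang (P m 0)" "replicate (2 * m) undefined \<in> lang ?p"
      using m by (auto simp: lang1 lang2 intro!: exI[of _ 1])
    then have "lang (P m 0) \<noteq> lang ?p" by blast
    then obtain x where x: "(x, x \<in> lang ?p) \<in> T" "(x \<in> lang (P m 0)) \<noteq> (x \<in> lang ?p)"
      using teaching_set_separates[OF T(2) QR(2)] by blast
    have x1: "x \<in> lang ?p \<and> length x \<noteq> m"
    proof -
      have "length x = m \<Longrightarrow> x \<in> lang ?p" unfolding lang1 by (intro exI[of _ 0]) simp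
      then show ?thesis using x(2) unfolding lang2 by blast
    qed
    have "{(u, False), (v, True), (x, True)} \<subseteq> T" using u v x u1 v1 x1 by simp
    moreover have "v \<noteq> x" using v1 x1 by blast
    then have "card {(u, False), (v, True), (x, True)} = 3" by simp
    ultimately show ?thesis using card_mono[OF T(1)] by metis
  qed
  then have "3 \<le> TD ?p (QR m)"
    unfolding TD_def by (intro Inf_greatest) (auto simp: numeral_eq_enat)
  then show ?thesis using QR(1) by blast
qed

lemma unary_TD_class:
  assumes "card (UNIV :: 'a set) = 1" "m \<ge> 1"
  shows "TD_class (QR m :: 'a pattern set) = 3"
proof (rule antisym)
  show "TD_class (QR m :: 'a pattern set) \<le> 3"
    unfolding TD_class_def by (rule SUP_least) (rule unary_TD_le[OF assms])
  obtain p where "p \<in> (QR m :: 'a pattern set)" "3 \<le> TD p (QR m)" using unary_TD_ge[OF assms] by blast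
  then show "3 \<le> TD_class (QR m :: 'a pattern set)"
    unfolding TD_class_def by (metis SUP_upper order_trans)
qed


lemma exists_distinct:
  assumes "infinite (UNIV :: 'a set) \<or> card (UNIV :: 'a set) \<ge> 2"
  obtains a b :: 'a where "a \<noteq> b"
proof (rule ccontr)
  assume "\<not> thesis"
  then have "(UNIV :: 'a set) = {undefined}" using that by blast
  then have "finite (UNIV :: 'a set) \<and> card (UNIV :: 'a set) = 1"
    by (metis finite.emptyI finite.insertI is_singletonI is_singleton_altdef)
  then show False using assms by simp
qed

theorem mainTheorem8:
  fixes m :: nat
  assumes "m \<ge> 1"
  shows "(card (UNIV :: 'a::countable set) = 1 \<longrightarrow> TD_class (QR m :: 'a pattern set) = 3)
    \<and> ((infinite (UNIV :: 'a set) \<or> card (UNIV :: 'a set) \<ge> 2) \<longrightarrow>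
       (\<exists>C :: real. \<forall>p \<in> (QR m :: 'a pattern set).
          let e = real (length (erase_vars p));
              D = max ((2 * real (length p) - e) / real m)
                      (1 + (e + real m + 4) * real (card (vars p)))
          in \<exists>n. TD p (QR m) = enat n \<and>
                 real n \<le> C * (2 powr e + D * (e + D * real m) powr (D * real m))))"
proof (intro conjI impI)
  assume "card (UNIV :: 'a set) = 1"
  then show "TD_class (QR m :: 'a pattern set) = 3" using assms by (rule unary_TD_class)
next
  assume "infinite (UNIV :: 'a set) \<or> card (UNIV :: 'a set) \<ge> 2"
  then obtain a b :: 'a where ab: "a \<noteq> b" by (rule exists_distinct)
  show "\<exists>C :: real. \<forall>p \<in> (QR m :: 'a pattern set).
          let e = real (length (erase_vars p));
              D = max ((2 * real (length p) - e) / real m)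
                      (1 + (e + real m + 4) * real (card (vars p)))
          in \<exists>n. TD p (QR m) = enat n \<and>
                 real n \<le> C * (2 powr e + D * (e + D * real m) powr (D * real m))"
    unfolding Let_def
    \<comment> \<open>The constant \<open>2\<close> is uniform in \<open>m\<close> and in the
      alphabet.\<close>
    by (intro exI[where x = "2 :: real"] ballI) (rule TD_bound[OF assms ab _ refl max.cobounded2])
qed

end
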